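(* Let $A,B\in\mathbb{Z}$ with $0<A\leq B$ and $B\geq 2$, let $M=\begin{pmatrix}0&-B\\1&-A\end{pmatrix}$ and $\mathcal{D}=\left\{\begin{pmatrix}0\\0\end{pmatrix},\begin{pmatrix}1\\0\end{pmatrix},\ldots,\begin{pmatrix}B-1\\0\end{pmatrix}\right\}$, and let $\mathcal{T}\subset\mathbb{R}^2$ be the unique nonempty compact set with $M\mathcal{T}=\bigcup_{d\in\mathcal{D}}(\mathcal{T}+d)$. If $2A-B\geq 5$, then $\mathcal{T}$ has at least one cut point, namely the point $$\sum_{j=1}^\infty M^{-j}\begin{pmatrix}c_j\\0\end{pmatrix},$$ where $c_j=A-3$ for odd $j$ and $c_j=B-1-(A-3)=B-A+2$ for even $j$.
   Context: The matrix $M$ is expanding (all eigenvalues have modulus greater than $1$), and $\mathcal{T}=\left\{\sum_{j\geq 1}M^{-j}\begin{pmatrix}a_j\\0\end{pmatrix};\ a_j\in\{0,\ldots,B-1\}\right\}$. A cut point of a connected set $T$ is a point $x\in T$ such that $T\setminus\{x\}$ is not connected. *)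

theory Defs
  imports "HOL-Analysis.Analysis"
begin

definition tile_matrix :: "int \<Rightarrow> int \<Rightarrow> real^2^2" where
  "tile_matrix A B = vector [vector [0, - of_int B], vector [1, - of_int A]]"

definition digit_vec :: "int \<Rightarrow> real^2" where
  "digit_vec k = vector [of_int k, 0]"

definition digit_set :: "int \<Rightarrow> (real^2) set" where
  "digit_set B = digit_vec ` {0..B - 1}"

text \<open>The operator \<open>^\<close> on type \<open>'a^'n^'n\<close> is the componentwise power, so the power
  with respect to the matrix product \<open>**\<close> needs its own definition.\<close>

primrec matrix_power :: "'a::semiring_1^'n^'n \<Rightarrow> nat \<Rightarrow> 'a^'n^'n" where
  "matrix_power M 0 = mat 1"
| "matrix_power M (Suc j) = M ** matrix_power M j"

definition cut_digit :: "int \<Rightarrow> int \<Rightarrow> nat \<Rightarrow> int" where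
  "cut_digit A B j = (if odd j then A - 3 else B - 1 - (A - 3))"

text \<open>Cut points are defined for connected sets only, so connectedness of \<open>T\<close> is part of the
  definition and hence has to be established for any set claimed to have a cut point.\<close>

definition cut_point :: "'a::topological_space set \<Rightarrow> 'a \<Rightarrow> bool" where
  "cut_point T x \<longleftrightarrow> connected T \<and> x \<in> T \<and> \<not> connected (T - {x})"

end

theory Submission
  imports Defs
begin

text \<open>Write \<open>K\<close> for the inverse of the matrix \<open>M\<close>, \<open>e\<close> for the first unit vector and
\<open>f\<^sub>d x = K (x + d e)\<close>, so that \<open>T\<close> is the union of the pieces \<open>f\<^sub>d T\<close>. The idea is that the point
lies in a piece of every level that is a cut vertex of the adjacency graph of that level.

Two pieces \<open>f\<^sub>d T\<close> and \<open>f\<^sub>e T\<close> meet if and only if \<open>(e - d, 0)\<close> is a difference of two points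
of \<open>T\<close>, and two pieces of the second level below \<open>f\<^sub>c\<close> and \<open>f\<^sub>c\<^sub>-\<^sub>1\<close>, with second digits
\<open>d\<close> and \<open>d'\<close>, meet if and only if \<open>(d - d', 1)\<close> is such a difference. Multiplying an integral
difference by \<open>M\<close> and subtracting a difference of digits yields another one, so, by compactness of
\<open>T\<close>, it generates a bounded integer sequence \<open>r\<close>, made of the second coordinates with alternating
sign, such that \<open>r (n + 2) - A r (n + 1) + B r n\<close> always has modulus at most \<open>B - 1\<close>. If
\<open>2 A - B \<ge> 5\<close>, such a sequence cannot start with \<open>0\<close> and a number greater than \<open>1\<close>, nor
with \<open>1\<close> and a number greater than \<open>2\<close>, because it would escape to infinity
(\<open>bounded_walk_from_0\<close>, \<open>bounded_walk_from_1\<close>). Hence only pieces with consecutive digits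
meet, and if the subpiece \<open>d\<close> of \<open>f\<^sub>c T\<close> meets \<open>f\<^sub>c\<^sub>-\<^sub>1 T\<close>, then \<open>d \<ge> A - 2\<close>; if it meets
\<open>f\<^sub>c\<^sub>+\<^sub>1 T\<close>, then \<open>d \<le> B - A + 1\<close>.

A digit from the range \<open>B - A + 2, \<dots>, A - 3\<close> therefore belongs to a subpiece that touches neither
neighbour of the piece around it. The subpieces with smaller digits can only touch the next piece,
and those with larger digits only the previous one. So for every address \<open>c\<close> with all digits in
this range, what is left of \<open>T\<close> outside the nested pieces along \<open>c\<close> falls into two disjoint
families: at odd levels the pieces before the nested one, at even levels those after it, and the
other way round. Each family becomes closed by adding the limit point of the nested pieces, so this
point is a cut point (\<open>not_connected_by_nested_pieces\<close>, \<open>cut_point_address\<close>). The digits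
\<open>A - 3\<close> and \<open>B - A + 2\<close> of the theorem are the two ends of the range.

Connectedness of \<open>T\<close> holds because consecutive pieces meet (\<open>ex_unit_difference\<close>), which makes
the pieces of every level a connected graph, while their diameters tend to \<open>0\<close>. This last fact
comes from the eigenvalues of \<open>M\<close>, which are real and less than \<open>-1\<close>.\<close>

section \<open>Bounded walks\<close>

text \<open>Such a sequence consists of the second coordinates, with alternating signs, of the lattice vectors
obtained from a difference of two points of the tile by repeatedly applying the matrix and
subtracting a difference of digits. The alternation turns the negative eigenvalues of the matrix
into positive ones, so that escaping walks are eventually monotone.\<close>

definition bounded_walk :: "int \<Rightarrow> int \<Rightarrow> (nat \<Rightarrow> int) \<Rightarrow> bool" where
  "bounded_walk A B r \<longleftrightarrow>
     (\<forall>n. \<bar>r (Suc (Suc n)) - A * r (Suc n) + B * r n\<bar> \<le> B - 1) \<and> (\<exists>C. \<forall>n. \<bar>r n\<bar> \<le> C)"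

lemma bounded_walk_step:
  assumes "bounded_walk A B r"
  shows "r (Suc (Suc n)) \<ge> A * r (Suc n) - B * r n - B + 1"
    and "r (Suc (Suc n)) \<le> A * r (Suc n) - B * r n + B - 1"
  using assms[unfolded bounded_walk_def, THEN conjunct1, THEN spec, of n] by linarith+

lemma bounded_walk_uminus:
  assumes "bounded_walk A B r"
  shows "bounded_walk A B (\<lambda>n. - r n)"
proof -
  have "\<bar>- r (Suc (Suc n)) - A * - r (Suc n) + B * - r n\<bar> \<le> B - 1" for n
    using bounded_walk_step[OF assms, of n] by (simp add: abs_le_iff)
  then show ?thesis using assms by (auto simp: bounded_walk_def)
qed

lemma bounded_walk_not_increasing:
  assumes "bounded_walk A B r" and "\<And>m. n \<le> m \<Longrightarrow> r m < r (Suc m)"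
  shows False
proof -
  obtain C where C: "\<And>m. \<bar>r m\<bar> \<le> C" using assms(1) by (auto simp: bounded_walk_def)
  have "r n + int j \<le> r (n + j)" for j
  proof (induction j)
    case (Suc j)
    then show ?case using assms(2)[of "n + j"] by simp
  qed simp
  from this[of "nat (C - r n + 1)"] C[of n] C[of "n + nat (C - r n + 1)"] show False by linarith
qed

text \<open>Once two consecutive terms grow by a factor of at least about \<open>k / (k - 1)\<close>, the same bound
holds for the next two, because the recursion then multiplies the last term by at least
\<open>A - B (k - 1) / k\<close>. The case \<open>k = 2\<close> of the rate condition is \<open>2 A - B \<ge> 5\<close>,
the case \<open>k = 3\<close> is \<open>3 A - 2 B \<ge> 5\<close>.\<close>

lemma bounded_walk_escape:
  fixes k :: int
  assumes w: "bounded_walk A B r" and k: "k \<ge> 2" and B: "B \<ge> 0"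
    and rate: "(k - 1) * (k * A - (k - 1) * B) \<ge> k\<^sup>2 + 1"
    and start: "r (Suc n) \<ge> k" "(k - 1) * r (Suc n) \<ge> k * (r n + 1)"
  shows False
proof -
  have inv: "r (Suc m) \<ge> k \<and> (k - 1) * r (Suc m) \<ge> k * (r m + 1)" if "n \<le> m" for m
    using that
  proof (induction m rule: dec_induct)
    case base
    then show ?case using start by simp
  next
    case (step m)
    define a b c where "a = r m" "b = r (Suc m)" "c = r (Suc (Suc m))"
    have ab: "b \<ge> k" "(k - 1) * b \<ge> k * (a + 1)" and c: "c \<ge> A * b - B * a - B + 1"
      using step bounded_walk_step(1)[OF w, of m] by (auto simp: a_b_c_def)
    have "k * c \<ge> k * (A * b - B * a - B + 1)" using c k by (intro mult_left_mono) auto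
    moreover have "B * ((k - 1) * b) \<ge> B * (k * (a + 1))" using ab B by (intro mult_left_mono) auto
    ultimately have "k * c \<ge> (k * A - (k - 1) * B) * b + k" by (simp add: algebra_simps)
    then have "(k - 1) * (k * c) \<ge> (k - 1) * ((k * A - (k - 1) * B) * b + k)"
      using k by (intro mult_left_mono) auto
    moreover have "(k - 1) * (k * A - (k - 1) * B) * b \<ge> (k\<^sup>2 + 1) * b"
      using rate ab k by (intro mult_right_mono) auto
    ultimately have "(k - 1) * (k * c) \<ge> (k\<^sup>2 + 1) * b + (k - 1) * k"
      by (simp add: algebra_simps)
    then have "k * ((k - 1) * c) \<ge> k * (k * (b + 1))"
      using ab(1) by (simp add: algebra_simps power2_eq_square)
    then have main: "(k - 1) * c \<ge> k * (b + 1)" using k by (simp add: mult_le_cancel_left)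
    have "(k - 1) * c > (k - 1) * b"
      using main ab(1) k by (simp add: algebra_simps)
    then have "c > b" using k by (simp add: mult_less_cancel_left)
    then show ?case using main ab(1) by (simp add: a_b_c_def)
  qed
  show False
  proof (rule bounded_walk_not_increasing[OF w])
    fix m assume "n \<le> m"
    from inv[OF this] have 1: "r (Suc m) \<ge> k" "(k - 1) * r (Suc m) \<ge> k * (r m + 1)" by auto
    show "r m < r (Suc m)"
    proof (rule ccontr)
      assume "\<not> r m < r (Suc m)"
      then have "(k - 1) * r (Suc m) \<le> (k - 1) * r m" using k by (intro mult_left_mono) auto
      then show False using 1 k \<open>\<not> r m < r (Suc m)\<close> by (simp add: algebra_simps)
    qed
  qed
qed

lemma bounded_walk_from_0:
  assumes "bounded_walk A B r" "A \<le> B" "2 * A - B \<ge> 5" "r 0 = 0"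
  shows "r 1 \<le> 1"
proof (rule ccontr)
  assume "\<not> r 1 \<le> 1"
  with assms show False
    by (intro bounded_walk_escape[of A B r 2 0]) auto
qed

text \<open>If the next term dropped below \<open>2\<close>, the term \<open>B * r n\<close> would push the walk so far into the
negative numbers that its reflection satisfies the escape condition with \<open>k = 2\<close>.\<close>

lemma bounded_walk_stays_ge_2:
  assumes w: "bounded_walk A B r" and AB: "A < B" "2 * A - B \<ge> 5" and "r n \<ge> 2"
  shows "r (Suc n) \<ge> 2"
proof (rule ccontr)
  assume neg: "\<not> r (Suc n) \<ge> 2"
  define u where "u = - r (Suc n)"
  have "B * r n \<ge> B * 2" using assms by (intro mult_left_mono) auto
  with bounded_walk_step(2)[OF w, of n] have 1: "- r (Suc (Suc n)) \<ge> A * u + B + 1"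
    by (simp add: u_def)
  have "A * (u + 1) \<ge> 2 * (u + 1)" using AB neg by (intro mult_right_mono) (auto simp: u_def)
  then have 2: "A * u \<ge> 2 * u + 2 - A" by (simp add: algebra_simps)
  have u: "u \<ge> -1" using neg by (simp add: u_def)
  have "- r (Suc (Suc n)) \<ge> 2" "- r (Suc (Suc n)) \<ge> 2 * (- r (Suc n) + 1)"
    using 1 2 u AB by (auto simp: u_def)
  then show False
    using bounded_walk_escape[OF bounded_walk_uminus[OF w], of 2 "Suc n"] AB by simp
qed

text \<open>The recursion is used backwards: since the terms stay positive, \<open>A * r (n + 1)\<close> must exceed
\<open>B * (r n - 1)\<close>. When \<open>A\<close> is at most about \<open>2 B / 3\<close>, the map \<open>x \<mapsto> B (x - 1) / A\<close> has a fixed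
point of at most about \<open>3\<close> and is expanding, so that terms from \<open>4\<close> on would increase for ever.\<close>

lemma bounded_walk_lt_4:
  assumes w: "bounded_walk A B r" and AB: "3 * A \<le> 2 * B + 4" "2 * A - B \<ge> 5" "A \<le> B"
  shows "r n < 4"
proof (rule ccontr)
  assume "\<not> r n < 4"
  have AB': "A < B" using AB by linarith
  note ge2 = bounded_walk_stays_ge_2[OF w AB' AB(2)]
  have ge4: "r (Suc m) \<ge> 4" if "r m \<ge> 4" for m
  proof (rule ccontr)
    assume "\<not> r (Suc m) \<ge> 4"
    then have "A * r (Suc m) \<le> A * 3" using AB by (intro mult_left_mono) auto
    moreover have "B * r m \<ge> B * 4" using AB that by (intro mult_left_mono) auto
    moreover have "r (Suc (Suc m)) \<ge> 2" using ge2[OF ge2[of m]] that by simp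
    ultimately show False using bounded_walk_step(2)[OF w, of m] AB by linarith
  qed
  have large: "r m \<ge> 4" if "n \<le> m" for m
    using that \<open>\<not> r n < 4\<close> by (induction m rule: dec_induct) (auto intro: ge4)
  show False
  proof (rule bounded_walk_not_increasing[OF w])
    fix m assume "n \<le> m"
    then have "r m \<ge> 4" using large by blast
    then have "r (Suc (Suc m)) \<ge> 4" using ge4 by blast
    show "r m < r (Suc m)"
    proof (rule ccontr)
      assume "\<not> r m < r (Suc m)"
      then have "A * r (Suc m) \<le> A * r m" using AB by (intro mult_left_mono) auto
      moreover have "(B - A) * 4 \<le> (B - A) * r m"
        using AB \<open>r m \<ge> 4\<close> by (intro mult_left_mono) auto
      then have "(B - A) * 4 \<le> B * r m - A * r m" by (simp only: left_diff_distrib)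
      ultimately have "3 * B + 5 \<le> 4 * A"
        using bounded_walk_step(2)[OF w, of m] \<open>r (Suc (Suc m)) \<ge> 4\<close> by (smt (verit))
      then show False using AB by linarith
    qed
  qed
qed

text \<open>The delicate start is \<open>1, 3\<close>. For \<open>3 A \<ge> 2 B + 5\<close> it escapes with ratio \<open>3 / 2\<close>. Otherwise the
third term must be \<open>2\<close> or \<open>3\<close> by the two preceding lemmas, and either value makes the fourth term
less than \<open>2\<close>.\<close>

lemma bounded_walk_from_1:
  assumes w: "bounded_walk A B r" and AB: "A \<le> B" "2 * A - B \<ge> 5" and r0: "r 0 = 1"
  shows "r 1 \<le> 2"
proof (rule ccontr)
  assume neg: "\<not> r 1 \<le> 2"
  show False
  proof (cases "r 1 \<ge> 4")
    case True
    then show False using bounded_walk_escape[OF w, of 2 0] AB r0 by simp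
  next
    case False
    with neg have r1: "r (Suc 0) = 3" by simp
    show False
    proof (cases "3 * A \<ge> 2 * B + 5")
      case True
      then show False using bounded_walk_escape[OF w, of 3 0] AB r0 r1 by simp
    next
      case False
      then have A3: "3 * A \<le> 2 * B + 4" "A < B" using AB by auto
      note ge2 = bounded_walk_stays_ge_2[OF w A3(2) AB(2)]
      have "r 2 \<ge> 2" "r 3 \<ge> 2" using ge2[of 1] ge2[of 2] r1 by (simp_all add: eval_nat_numeral)
      moreover have "r 2 < 4" using bounded_walk_lt_4[OF w A3(1) AB(2,1)] .
      moreover have "3 * A - 2 * B + 1 \<le> r 2"
        using bounded_walk_step(1)[OF w, of 0] r0 r1 by (simp add: eval_nat_numeral)
      moreover have "r 3 \<le> A * r 2 - 2 * B - 1"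
        using bounded_walk_step(2)[OF w, of 1] r1 by (simp add: eval_nat_numeral)
      moreover have "r 2 = 2 \<or> r 2 = 3" using calculation by linarith
      ultimately show False using A3 by auto
    qed
  qed
qed

section \<open>A cut point from nested pieces\<close>

text \<open>Each of the two unions, of all \<open>P n\<close> and of all \<open>Q n\<close>, has \<open>x\<close> as its only possible
further limit point: all but finitely many of its members lie in \<open>F n\<close>. Disjointness has to be
checked for equal and neighbouring indices only, as later pieces lie in \<open>F (n + 2)\<close>.\<close>

lemma not_connected_by_nested_pieces:
  fixes F P Q :: "nat \<Rightarrow> 'a::t1_space set"
  assumes closed: "\<And>n. closed (F n)" "\<And>n. closed (P n)" "\<And>n. closed (Q n)"
    and split: "\<And>n. F n = P n \<union> F (Suc n) \<union> Q n"
    and disj: "\<And>n. P n \<inter> Q n = {}" "\<And>n. P n \<inter> Q (Suc n) = {}" "\<And>n. Q n \<inter> P (Suc n) = {}"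
      "\<And>n. P n \<inter> F (Suc (Suc n)) = {}" "\<And>n. Q n \<inter> F (Suc (Suc n)) = {}"
    and ne: "P 0 \<noteq> {}" "Q 0 \<noteq> {}"
    and x: "(\<Inter>n. F n) = {x}"
  shows "\<not> connected (F 0 - {x})"
proof -
  have dec: "F n \<subseteq> F m" if "m \<le> n" for m n
    using that by (induction n rule: dec_induct) (use split in blast)+
  have sub: "P n \<subseteq> F m" "Q n \<subseteq> F m" if "m \<le> n" for m n
    using dec[OF that] split[of n] by blast+
  define U where "U = (\<Union>n. P n)"
  define V where "V = (\<Union>n. Q n)"
  have xF: "x \<in> F n" for n using x by blast
  have "P m \<inter> Q n = {}" for m n
  proof -
    consider "m = n" | "n = Suc m" | "m = Suc n" | "Suc (Suc m) \<le> n" | "Suc (Suc n) \<le> m"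
      by linarith
    then show ?thesis
    proof cases
      case 1
      then show ?thesis using disj(1) by simp
    next
      case 2
      then show ?thesis using disj(2) by simp
    next
      case 3
      then show ?thesis using disj(3)[of n] by (simp add: Int_commute)
    next
      case 4
      then show ?thesis using disj(4)[of m] sub(2) by blast
    next
      case 5
      then show ?thesis using disj(5)[of n] sub(1) by blast
    qed
  qed
  then have UV: "U \<inter> V = {}" by (auto simp: U_def V_def)
  have "x \<notin> P n" "x \<notin> Q n" for n using xF[of "Suc (Suc n)"] disj(4,5)[of n] by blast+
  then have xU: "x \<notin> U" and xV: "x \<notin> V" by (simp_all add: U_def V_def)
  have cover: "\<exists>m. y \<in> P m \<or> y \<in> Q m" if "y \<in> F 0" "y \<noteq> x" for y
  proof -
    have "y \<notin> (\<Inter>n. F n)" unfolding x using that by simp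
    then obtain n where "y \<notin> F n" by blast
    then show ?thesis
    proof (induction n)
      case 0
      then show ?case using that by simp
    next
      case (Suc n)
      then show ?case using split[of n] by blast
    qed
  qed
  have closed_side: "closed ((\<Union>n. X n) \<union> {x})"
    if Xc: "\<And>n. closed (X n)" and Xs: "\<And>m n. m \<le> n \<Longrightarrow> X n \<subseteq> F m" for X
  proof -
    have "(\<Union>n. X n) \<union> {x} = (\<Inter>n. (\<Union>k<n. X k) \<union> F n)"
    proof (intro equalityI subsetI)
      fix y assume y: "y \<in> (\<Union>n. X n) \<union> {x}"
      have "y \<in> (\<Union>k<n. X k) \<union> F n" for n
      proof (cases "y = x")
        case False
        then obtain k where "y \<in> X k" using y by blast
        then show ?thesis using Xs[of n k] by (cases "k < n") auto
      qed (use xF in simp)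
      then show "y \<in> (\<Inter>n. (\<Union>k<n. X k) \<union> F n)" by blast
    next
      fix y assume "y \<in> (\<Inter>n. (\<Union>k<n. X k) \<union> F n)"
      then have "y \<in> (\<Union>n. X n) \<union> (\<Inter>n. F n)" by blast
      then show "y \<in> (\<Union>n. X n) \<union> {x}" unfolding x .
    qed
    moreover have "closed (\<Inter>n. (\<Union>k<n. X k) \<union> F n)"
      using Xc closed by (intro closed_INT ballI closed_Un closed_UN) auto
    ultimately show ?thesis by simp
  qed
  have clo: "closed (U \<union> {x})" "closed (V \<union> {x})"
    unfolding U_def V_def by (rule closed_side; use closed sub in blast)+
  have PU: "P n \<subseteq> U" and QV: "Q n \<subseteq> V" for n by (auto simp: U_def V_def)
  have "F 0 - {x} \<subseteq> (U \<union> {x}) \<union> (V \<union> {x})"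
  proof
    fix y assume "y \<in> F 0 - {x}"
    then obtain m where "y \<in> P m \<or> y \<in> Q m" using cover by blast
    then show "y \<in> (U \<union> {x}) \<union> (V \<union> {x})" using PU[of m] QV[of m] by blast
  qed
  moreover have "(U \<union> {x}) \<inter> (V \<union> {x}) \<inter> (F 0 - {x}) = {}" using UV by blast
  moreover have "(U \<union> {x}) \<inter> (F 0 - {x}) \<noteq> {}"
    using ne(1) sub(1)[of 0 0] PU[of 0] xU by blast
  moreover have "(V \<union> {x}) \<inter> (F 0 - {x}) \<noteq> {}"
    using ne(2) sub(2)[of 0 0] QV[of 0] xV by blast
  ultimately show ?thesis
    unfolding connected_closed not_not using clo
    by (intro exI[of _ "U \<union> {x}"] exI[of _ "V \<union> {x}"] conjI)
qed

section \<open>The matrix\<close>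

lemma tile_matrix_mult_vec:
  "tile_matrix A B *v x = vector [- of_int B * x $ 2, x $ 1 - of_int A * x $ 2]"
  by (simp add: vec_eq_iff forall_2 matrix_vector_mult_def sum_2 tile_matrix_def)

lemma digit_vec_nth [simp]: "digit_vec k $ 1 = of_int k" "digit_vec k $ 2 = 0"
  by (simp_all add: digit_vec_def)

lemma matrix_power_Suc_right:
  "matrix_power K (Suc n) = matrix_power K n ** (K :: 'a::semiring_1^'n^'n)"
  by (induction n) (simp_all add: matrix_mul_assoc)

locale collinear_tile =
  fixes A B :: int and T :: "(real^2) set"
  assumes A_le_B: "A \<le> B" and gap: "2 * A - B \<ge> 5"
    and compact_T: "compact T" and T_ne: "T \<noteq> {}"
    and T_eq: "(\<lambda>x. tile_matrix A B *v x) ` T = (\<Union>d\<in>digit_set B. (\<lambda>x. x + d) ` T)"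
begin

abbreviation M :: "real^2^2" where "M \<equiv> tile_matrix A B"
abbreviation K :: "real^2^2" where "K \<equiv> matrix_inv M"

lemma A_ge: "A \<ge> 5" and B_ge: "B \<ge> 5"
  using A_le_B gap by linarith+

lemma invertible_M: "invertible M"
proof -
  have "det M = of_int B" by (simp add: det_2 tile_matrix_def)
  then show ?thesis using B_ge by (simp add: invertible_det_nz)
qed

lemma M_K [simp]: "M *v (K *v x) = x" and K_M [simp]: "K *v (M *v x) = x"
proof -
  have "M ** K = mat 1 \<and> K ** M = mat 1"
    using invertible_M unfolding invertible_def matrix_inv_def by (rule someI_ex)
  then show "M *v (K *v x) = x" "K *v (M *v x) = x" by (simp_all add: matrix_vector_mul_assoc)
qed

text \<open>The assumption \<open>2 A - B \<ge> 5\<close> makes the discriminant \<open>A\<^sup>2 - 4 B\<close> positive, and \<open>A \<le> B\<close> makes both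
roots \<open>l\<close> of \<open>l\<^sup>2 - A l + B\<close> greater than \<open>1\<close>. The linear functional \<open>x $ 1 - l * x $ 2\<close> is a left
eigenvector of \<open>M\<close> for the eigenvalue \<open>- l\<close>. The two functionals together define a norm for which
the powers of \<open>K\<close> contract geometrically, with the ratio given by the smaller root.\<close>

lemma matrix_power_K_contracts:
  "\<exists>C \<rho>. 0 \<le> C \<and> 0 \<le> \<rho> \<and> \<rho> < 1 \<and> (\<forall>n x. norm (matrix_power K n *v x) \<le> C * \<rho> ^ n * norm x)"
proof -
  have disc: "real_of_int (A\<^sup>2 - 4 * B) > 0"
  proof -
    have "(2 * A)\<^sup>2 \<ge> (B + 5)\<^sup>2" using gap B_ge by (intro power_mono) auto
    moreover have "(B + 5)\<^sup>2 - 16 * B = (B - 3)\<^sup>2 + 16" by (simp add: power2_eq_square algebra_simps)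
    moreover have "(B - 3)\<^sup>2 \<ge> 0" by simp
    ultimately have "4 * (A\<^sup>2 - 4 * B) > 0" by (simp add: power2_eq_square algebra_simps)
    then show ?thesis by (simp only: of_int_0_less_iff) simp
  qed
  define s where "s = sqrt (real_of_int (A\<^sup>2 - 4 * B))"
  have s: "s > 0" "s\<^sup>2 = real_of_int A ^ 2 - 4 * real_of_int B" using disc by (auto simp: s_def)
  have s_lt: "s < real_of_int A - 2"
  proof (rule power_less_imp_less_base)
    show "s\<^sup>2 < (real_of_int A - 2)\<^sup>2"
      using A_le_B unfolding s(2) by (simp add: power2_eq_square algebra_simps)
  qed (use A_ge in simp)
  define l1 l2 where "l1 = (real_of_int A - s) / 2" and "l2 = (real_of_int A + s) / 2"
  have l: "1 < l1" "l1 < l2" using s s_lt by (auto simp: l1_def l2_def)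
  have root: "l1 * l1 = A * l1 - B" "l2 * l2 = A * l2 - B"
    using s(2) by (auto simp: l1_def l2_def field_simps power2_eq_square)
  define \<phi> :: "real \<Rightarrow> real^2 \<Rightarrow> real" where "\<phi> l x = x $ 1 - l * x $ 2" for l x
  have phi_M: "\<phi> l (M *v x) = - l * \<phi> l x" if "l * l = A * l - B" for l :: real and x
  proof -
    have "\<phi> l (M *v x) = (A * l - B) * x $ 2 - l * x $ 1"
      by (simp add: \<phi>_def tile_matrix_mult_vec algebra_simps)
    then show ?thesis unfolding that[symmetric] by (simp add: \<phi>_def algebra_simps)
  qed
  have phi_K: "\<bar>\<phi> l (matrix_power K n *v x)\<bar> \<le> \<bar>\<phi> l x\<bar> * (1 / l1) ^ n"
    if lr: "l * l = A * l - B" and ll: "l1 \<le> l" for l :: real and n x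
  proof (induction n)
    case (Suc n)
    define y where "y = matrix_power K n *v x"
    have "\<phi> l y = - l * \<phi> l (K *v y)" using phi_M[OF lr, of "K *v y"] by simp
    then have "\<bar>\<phi> l (K *v y)\<bar> = \<bar>\<phi> l y\<bar> * (1 / l)" using ll l by (auto simp: abs_mult)
    also have "\<dots> \<le> (\<bar>\<phi> l x\<bar> * (1 / l1) ^ n) * (1 / l1)"
      using Suc l ll by (intro mult_mono) (auto simp: y_def frac_le)
    finally show ?case by (simp add: y_def matrix_vector_mul_assoc[symmetric] mult_ac)
  qed simp
  \<comment> \<open>From solving the two functionals for the coordinates; the summand \<open>1\<close> pays for the first
    functional in \<open>x $ 1 = \<phi> l1 x + l1 * x $ 2\<close>.\<close>
  define c where "c = (1 + l1) / (l2 - l1) + 1"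
  have c: "c \<ge> 0" using l by (simp add: c_def)
  have norm_le: "norm x \<le> c * (\<bar>\<phi> l1 x\<bar> + \<bar>\<phi> l2 x\<bar>)" for x
  proof -
    have x2: "x $ 2 = (\<phi> l1 x - \<phi> l2 x) / (l2 - l1)" using l by (simp add: \<phi>_def field_simps)
    have x1: "x $ 1 = \<phi> l1 x + l1 * x $ 2" by (simp add: \<phi>_def)
    have "norm x \<le> \<bar>x $ 1\<bar> + \<bar>x $ 2\<bar>" using norm_le_l1_cart[of x] by (simp add: sum_2)
    also have "\<dots> \<le> \<bar>\<phi> l1 x\<bar> + (1 + l1) * \<bar>x $ 2\<bar>"
      using l abs_triangle_ineq[of "\<phi> l1 x" "l1 * x $ 2"] x1 by (simp add: abs_mult algebra_simps)
    also have "\<bar>x $ 2\<bar> \<le> (\<bar>\<phi> l1 x\<bar> + \<bar>\<phi> l2 x\<bar>) / (l2 - l1)"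
      using l unfolding x2 by (auto simp: abs_divide intro!: divide_right_mono)
    then have "\<bar>\<phi> l1 x\<bar> + (1 + l1) * \<bar>x $ 2\<bar>
        \<le> (\<bar>\<phi> l1 x\<bar> + \<bar>\<phi> l2 x\<bar>) + (1 + l1) * ((\<bar>\<phi> l1 x\<bar> + \<bar>\<phi> l2 x\<bar>) / (l2 - l1))"
      using l by (intro add_mono mult_left_mono) auto
    also have "\<dots> = c * (\<bar>\<phi> l1 x\<bar> + \<bar>\<phi> l2 x\<bar>)" by (simp add: c_def algebra_simps add_divide_distrib)
    finally show ?thesis .
  qed
  have phi_le: "\<bar>\<phi> l x\<bar> \<le> (1 + l2) * norm x" if "0 \<le> l" "l \<le> l2" for l x
  proof -
    have "\<bar>l * x $ 2\<bar> = l * \<bar>x $ 2\<bar>" using that by (simp add: abs_mult)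
    then have "\<bar>\<phi> l x\<bar> \<le> \<bar>x $ 1\<bar> + l * \<bar>x $ 2\<bar>"
      using abs_triangle_ineq4[of "x $ 1" "l * x $ 2"] by (simp only: \<phi>_def)
    also have "\<dots> \<le> norm x + l2 * norm x"
      using that l by (intro add_mono mult_mono component_le_norm_cart) auto
    finally show ?thesis by (simp add: algebra_simps)
  qed
  have "norm (matrix_power K n *v x) \<le> (c * (2 * (1 + l2))) * (1 / l1) ^ n * norm x" for n x
  proof -
    have "norm (matrix_power K n *v x)
        \<le> c * (\<bar>\<phi> l1 (matrix_power K n *v x)\<bar> + \<bar>\<phi> l2 (matrix_power K n *v x)\<bar>)"
      by (rule norm_le)
    also have "\<dots> \<le> c * (\<bar>\<phi> l1 x\<bar> * (1 / l1) ^ n + \<bar>\<phi> l2 x\<bar> * (1 / l1) ^ n)"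
      using phi_K[OF root(1), of n x] phi_K[OF root(2), of n x] c l
      by (intro mult_left_mono add_mono) simp_all
    also have "\<dots> \<le> c * ((1 + l2) * norm x * (1 / l1) ^ n + (1 + l2) * norm x * (1 / l1) ^ n)"
      by (intro mult_left_mono add_mono mult_right_mono phi_le) (use c l in simp_all)
    finally show ?thesis by (simp add: algebra_simps)
  qed
  then show ?thesis
    using c l by (intro exI[of _ "c * (2 * (1 + l2))"] exI[of _ "1 / l1"]) auto
qed

lemma matrix_power_K_uniformly_small:
  assumes "bounded S" "e > 0"
  obtains N where "\<And>n x. n \<ge> N \<Longrightarrow> x \<in> S \<Longrightarrow> norm (matrix_power K n *v x) < e"
proof -
  obtain C \<rho> where C: "0 \<le> C" "0 \<le> \<rho>" "\<rho> < 1"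
      "\<And>n x. norm (matrix_power K n *v x) \<le> C * \<rho> ^ n * norm x"
    using matrix_power_K_contracts by blast
  obtain b where b: "b > 0" "\<And>x. x \<in> S \<Longrightarrow> norm x \<le> b" using assms(1) bounded_pos by metis
  have "(\<lambda>n. C * \<rho> ^ n * b) \<longlonglongrightarrow> C * 0 * b"
    using C by (intro tendsto_intros LIMSEQ_power_zero) auto
  then have "\<forall>\<^sub>F n in sequentially. C * \<rho> ^ n * b < e"
    using assms(2) by (intro order_tendstoD(2)) auto
  then obtain N where N: "\<And>n. n \<ge> N \<Longrightarrow> C * \<rho> ^ n * b < e"
    unfolding eventually_sequentially by blast
  show ?thesis
  proof (rule that)
    fix n x assume "n \<ge> N" "x \<in> S"
    have "norm (matrix_power K n *v x) \<le> C * \<rho> ^ n * b"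
      using C b(2)[OF \<open>x \<in> S\<close>] by (intro order_trans[OF C(4)] mult_left_mono) auto
    then show "norm (matrix_power K n *v x) < e" using N[OF \<open>n \<ge> N\<close>] by linarith
  qed
qed

section \<open>Subpieces and addresses\<close>

definition piece_map :: "int \<Rightarrow> real^2 \<Rightarrow> real^2" where
  "piece_map d x = K *v (x + digit_vec d)"

lemma M_piece_map [simp]: "M *v piece_map d x = x + digit_vec d"
  by (simp add: piece_map_def)

lemma piece_map_eq_iff: "piece_map d x = piece_map e y \<longleftrightarrow> x + digit_vec d = y + digit_vec e"
proof
  assume "piece_map d x = piece_map e y"
  then have "M *v piece_map d x = M *v piece_map e y" by (rule arg_cong)
  then show "x + digit_vec d = y + digit_vec e" by (simp only: M_piece_map)
qed (simp add: piece_map_def)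

lemma T_decomp: "T = (\<Union>d\<in>{0..B - 1}. piece_map d ` T)"
proof -
  have "T = (\<lambda>x. K *v x) ` ((\<lambda>x. M *v x) ` T)" by (simp add: image_image)
  then show ?thesis
    unfolding T_eq by (simp add: digit_set_def piece_map_def image_UN image_image)
qed

lemma ex_piece:
  assumes "x \<in> T"
  shows "\<exists>d y. 0 \<le> d \<and> d < B \<and> y \<in> T \<and> x = piece_map d y"
  using assms by (subst (asm) T_decomp) auto

lemma piece_map_in_T: "x \<in> T \<Longrightarrow> 0 \<le> d \<Longrightarrow> d < B \<Longrightarrow> piece_map d x \<in> T"
  by (subst T_decomp) auto

text \<open>The composition of the piece maps for the first \<open>n\<close> digits of \<open>c\<close>, with the first digit applied
last: its images of \<open>T\<close> for increasing \<open>n\<close> are nested pieces of \<open>T\<close>.\<close>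

primrec word_map :: "(nat \<Rightarrow> int) \<Rightarrow> nat \<Rightarrow> real^2 \<Rightarrow> real^2" where
  "word_map c 0 = id"
| "word_map c (Suc n) = word_map c n \<circ> piece_map (c n)"

lemma word_map_eq:
  "word_map c n x = (\<Sum>j<n. matrix_power K (Suc j) *v digit_vec (c j)) + matrix_power K n *v x"
proof (induction n arbitrary: x)
  case (Suc n)
  show ?case
    by (simp only: word_map.simps o_apply Suc piece_map_def matrix_power_Suc_right
        matrix_vector_mul_assoc sum.lessThan_Suc matrix_vector_right_distrib) simp
qed simp

lemma inj_word_map: "inj (word_map c n)"
proof (induction n)
  case (Suc n)
  have "inj (piece_map (c n))" by (auto intro!: injI simp: piece_map_eq_iff)
  then show ?case using inj_compose[OF Suc] by (simp only: word_map.simps)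
qed simp

lemma compact_word_map: "compact S \<Longrightarrow> compact (word_map c n ` S)"
proof (rule compact_continuous_image)
  show "continuous_on S (word_map c n)"
    unfolding continuous_on_cong[OF refl word_map_eq]
    by (intro continuous_on_add continuous_on_const linear_continuous_on
        matrix_vector_mul_bounded_linear)
qed

definition digits :: "(nat \<Rightarrow> int) \<Rightarrow> bool" where
  "digits c \<longleftrightarrow> (\<forall>n. 0 \<le> c n \<and> c n < B)"

text \<open>Compactness provides a point in all nested pieces. Any such point differs from the \<open>n\<close>-th partial
sum of the series by \<open>matrix_power K n *v t\<close> for some \<open>t\<close> in \<open>T\<close>, which tends to \<open>0\<close>. Therefore
the series converges to it, and the point is unique.\<close>

lemma ex_point_of_address:
  assumes "digits c"
  shows "\<exists>x. (\<Inter>n. word_map c n ` T) = {x} \<and>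
    (\<lambda>j. matrix_power K (Suc j) *v digit_vec (c j)) sums x"
proof -
  have bT: "bounded T" using compact_T compact_imp_bounded by blast
  have dec: "word_map c n ` T \<subseteq> word_map c m ` T" if "m \<le> n" for m n
    using that
  proof (induction n rule: dec_induct)
    case (step n)
    have "piece_map (c n) ` T \<subseteq> T" using assms by (auto simp: digits_def intro: piece_map_in_T)
    then show ?case using step by (force simp: image_comp[symmetric])
  qed simp
  have "\<Inter>(range (\<lambda>n. word_map c n ` T)) \<noteq> {}"
    using compact_T T_ne dec by (intro compact_nest compact_word_map) auto
  then obtain x where x: "\<And>n. x \<in> word_map c n ` T" by auto
  have sums: "(\<lambda>j. matrix_power K (Suc j) *v digit_vec (c j)) sums y"
    if y: "\<And>n. y \<in> word_map c n ` T" for y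
    unfolding sums_def
  proof (rule LIMSEQ_I)
    fix e :: real assume "e > 0"
    obtain N where N: "\<And>n z. n \<ge> N \<Longrightarrow> z \<in> T \<Longrightarrow> norm (matrix_power K n *v z) < e"
      using matrix_power_K_uniformly_small[OF bT \<open>e > 0\<close>] by blast
    have "norm ((\<Sum>j<n. matrix_power K (Suc j) *v digit_vec (c j)) - y) < e" if "n \<ge> N" for n
    proof -
      obtain t where "t \<in> T" "y = word_map c n t" using y[of n] by blast
      then show ?thesis using N[OF that] by (simp add: word_map_eq)
    qed
    then show "\<exists>N. \<forall>n\<ge>N. norm ((\<Sum>j<n. matrix_power K (Suc j) *v digit_vec (c j)) - y) < e"
      by blast
  qed
  have "y = x" if "\<And>n. y \<in> word_map c n ` T" for y
    using sums_unique2[OF sums[OF that] sums[OF x]] .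
  then have "(\<Inter>n. word_map c n ` T) = {x}" using x by (intro equalityI subsetI) auto
  then show ?thesis using sums[OF x] by blast
qed

definition address_point :: "(nat \<Rightarrow> int) \<Rightarrow> real^2" where
  "address_point c = (\<Sum>j. matrix_power K (Suc j) *v digit_vec (c j))"

lemma address_point:
  assumes "digits c"
  shows "(\<Inter>n. word_map c n ` T) = {address_point c}"
    and "(\<lambda>j. matrix_power K (Suc j) *v digit_vec (c j)) sums address_point c"
    and "address_point c \<in> T"
proof -
  show 1: "(\<Inter>n. word_map c n ` T) = {address_point c}"
    and "(\<lambda>j. matrix_power K (Suc j) *v digit_vec (c j)) sums address_point c"
    using ex_point_of_address[OF assms] by (auto simp: address_point_def sums_iff)
  from 1 have "address_point c \<in> word_map c 0 ` T" by blast
  then show "address_point c \<in> T" by simp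
qed

lemma address_point_shift:
  assumes "digits c"
  shows "address_point c = piece_map (c 0) (address_point (\<lambda>n. c (Suc n)))"
proof -
  have d: "digits (\<lambda>n. c (Suc n))" using assms by (simp add: digits_def)
  have "(\<lambda>j. K *v (matrix_power K (Suc j) *v digit_vec (c (Suc j))))
      sums (K *v address_point (\<lambda>n. c (Suc n)))"
    by (rule bounded_linear.sums[OF matrix_vector_mul_bounded_linear address_point(2)[OF d]])
  then have "(\<lambda>j. matrix_power K (Suc (Suc j)) *v digit_vec (c (Suc j)))
      sums (K *v address_point (\<lambda>n. c (Suc n)))"
    by (simp add: matrix_vector_mul_assoc)
  then have "(\<lambda>j. matrix_power K (Suc j) *v digit_vec (c j))
      sums (K *v address_point (\<lambda>n. c (Suc n)) + matrix_power K (Suc 0) *v digit_vec (c 0))"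
    by (subst (asm) sums_Suc_iff) simp
  then show ?thesis
    using address_point(2)[OF assms] sums_unique2
    by (fastforce simp: piece_map_def matrix_vector_right_distrib)
qed

section \<open>Connectedness\<close>

text \<open>The points \<open>t\<close> and \<open>u\<close> with the addresses \<open>0, g, 0, g, \<dots>\<close> and \<open>g, 0, g, 0, \<dots>\<close>, where
\<open>g = B - A + 1\<close>, are exchanged by \<open>M\<close> up to digits. This determines
\<open>t - u = (A - 1, 1)\<close>, which is \<open>M *v digit_vec 1 + digit_vec (A - 1)\<close>. Hence putting the digits
\<open>0\<close> and \<open>A - 1\<close> in front of the two addresses gives points that differ by \<open>digit_vec 1\<close>.\<close>

lemma ex_unit_difference: "\<exists>x\<in>T. \<exists>y\<in>T. x = y + digit_vec 1"
proof -
  define g where "g = B - A + 1"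
  define a b where "a n = (if even n then 0 else g)" and "b n = (if even n then g else 0)" for n :: nat
  have ab: "digits a" "digits b" "(\<lambda>n. a (Suc n)) = b" "(\<lambda>n. b (Suc n)) = a"
    using A_le_B A_ge by (auto simp: digits_def a_def b_def g_def)
  define t u where "t = address_point a" and "u = address_point b"
  have tu: "t \<in> T" "u \<in> T" using ab address_point(3) by (auto simp: t_def u_def)
  have "t = piece_map 0 u" and "u = piece_map g t"
    using address_point_shift[OF ab(1)] address_point_shift[OF ab(2)] ab(3,4)
    by (auto simp: t_def u_def a_def b_def)
  then have Mt: "M *v t = u + digit_vec 0" and Mu: "M *v u = t + digit_vec g"
    by (metis M_piece_map)+
  have eqs: "- B * t $ 2 = u $ 1" "t $ 1 - A * t $ 2 = u $ 2"
      "- B * u $ 2 = t $ 1 + g" "u $ 1 - A * u $ 2 = t $ 2"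
    using arg_cong[OF Mt, of "\<lambda>v. v $ 1"] arg_cong[OF Mt, of "\<lambda>v. v $ 2"]
      arg_cong[OF Mu, of "\<lambda>v. v $ 1"] arg_cong[OF Mu, of "\<lambda>v. v $ 2"]
    by (simp_all add: tile_matrix_mult_vec)
  have "g * (t $ 2 - u $ 2 - 1) = 0"
    using eqs unfolding g_def by (simp add: algebra_simps)
  moreover have "g \<noteq> 0" using A_le_B by (simp add: g_def)
  ultimately have q: "t $ 2 - u $ 2 = 1" by simp
  have p: "t $ 1 - u $ 1 = A - 1"
  proof -
    have "t $ 1 - u $ 1 = (A - 1) * (t $ 2 - u $ 2)" using eqs by (simp add: algebra_simps)
    then show ?thesis using q by simp
  qed
  have "piece_map 0 t = piece_map (A - 1) u + digit_vec 1"
  proof -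
    have "M *v digit_vec 1 = vector [0, 1]" by (simp add: tile_matrix_mult_vec)
    moreover have "t = u + digit_vec (A - 1) + vector [0, 1]"
      using p q by (simp add: vec_eq_iff forall_2)
    ultimately have "K *v t = K *v (u + digit_vec (A - 1)) + K *v (M *v digit_vec 1)"
      by (simp add: matrix_vector_right_distrib)
    moreover have "digit_vec 0 = 0" by (simp add: vec_eq_iff forall_2)
    ultimately show ?thesis by (simp add: piece_map_def)
  qed
  moreover have "piece_map 0 t \<in> T" "piece_map (A - 1) u \<in> T"
    using tu A_ge A_le_B by (auto intro!: piece_map_in_T)
  ultimately show ?thesis by blast
qed

text \<open>The pieces of \<open>T\<close> form a chain in which neighbours share a point, so the constant values agree.
Allowing an arbitrary function \<open>\<psi>\<close> lets the argument be applied to \<open>\<psi>\<close> composed with the map of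
a word, and thus be iterated along words below.\<close>

lemma constant_on_pieces_imp_constant:
  fixes \<psi> :: "real^2 \<Rightarrow> 'b"
  assumes "\<And>d. 0 \<le> d \<Longrightarrow> d < B \<Longrightarrow> (\<psi> \<circ> piece_map d) constant_on T"
  shows "\<psi> constant_on T"
proof -
  obtain x y where xy: "x \<in> T" "y \<in> T" "x = y + digit_vec 1" using ex_unit_difference by blast
  have const: "\<psi> (piece_map d u) = \<psi> (piece_map d v)" if "0 \<le> d" "d < B" "u \<in> T" "v \<in> T" for d u v
    using assms[of d] that unfolding constant_on_def by fastforce
  have all: "\<psi> (piece_map d x) = \<psi> (piece_map 0 x)" if "0 \<le> d" "d < B" for d
    using that
  proof (induction d rule: int_ge_induct)
    case (step d)
    have "piece_map d x = piece_map (d + 1) y"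
      unfolding piece_map_eq_iff xy(3) by (simp add: vec_eq_iff forall_2)
    then show ?case using step const[of "d + 1" x y] xy by simp
  qed simp
  have "\<psi> z = \<psi> (piece_map 0 x)" if z: "z \<in> T" for z
  proof -
    obtain d u where "0 \<le> d" "d < B" "u \<in> T" "z = piece_map d u"
      using ex_piece[OF z] by blast
    then show ?thesis using const[of d u x] all[of d] xy by simp
  qed
  then show ?thesis unfolding constant_on_def by blast
qed

lemma constant_on_words_imp_constant:
  fixes \<psi> :: "real^2 \<Rightarrow> 'b"
  assumes "\<And>c. digits c \<Longrightarrow> (\<psi> \<circ> word_map c n) constant_on T"
  shows "\<psi> constant_on T"
  using assms
proof (induction n)
  case 0
  have "digits (\<lambda>_. 0)" using B_ge by (simp add: digits_def)
  then show ?case using 0 by fastforce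
next
  case (Suc n)
  show ?case
  proof (rule Suc.IH)
    fix c assume c: "digits c"
    show "(\<psi> \<circ> word_map c n) constant_on T"
    proof (rule constant_on_pieces_imp_constant)
      fix d assume d: "0 \<le> d" "d < B"
      have "word_map (c(n := d)) m = word_map c m" if "m \<le> n" for m
        using that by (induction m) auto
      then have "word_map (c(n := d)) (Suc n) = word_map c n \<circ> piece_map d" by simp
      moreover have "digits (c(n := d))" using c d by (simp add: digits_def)
      ultimately show "(\<psi> \<circ> word_map c n \<circ> piece_map d) constant_on T"
        using Suc.prems[of "c(n := d)"] by (simp only: o_assoc)
    qed
  qed
qed

text \<open>Two disjoint closed parts of \<open>T\<close> have positive distance. A sufficiently small piece lies in only
one of them, so membership in one part is constant on all pieces of some level, hence on \<open>T\<close>.\<close>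

lemma connected_T: "connected T"
proof (rule ccontr)
  assume "\<not> connected T"
  then obtain U V where UV: "closed U" "closed V" "T \<subseteq> U \<union> V" "U \<inter> V \<inter> T = {}"
      "U \<inter> T \<noteq> {}" "V \<inter> T \<noteq> {}"
    unfolding connected_closed by blast
  have "compact (U \<inter> T)" "closed (V \<inter> T)"
    using UV compact_T by (auto simp: closed_Int_compact compact_imp_closed)
  moreover have "(U \<inter> T) \<inter> (V \<inter> T) = {}" using UV by blast
  ultimately obtain e where e: "e > 0" "\<And>x y. x \<in> U \<inter> T \<Longrightarrow> y \<in> V \<inter> T \<Longrightarrow> e \<le> dist x y"
    using separate_compact_closed by metis
  have "bounded ((\<lambda>(x, y). x - y) ` (T \<times> T))"
    using compact_T by (intro bounded_minus) (simp_all add: compact_imp_bounded)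
  then obtain N where N: "\<And>n z. n \<ge> N \<Longrightarrow> z \<in> (\<lambda>(x, y). x - y) ` (T \<times> T) \<Longrightarrow>
      norm (matrix_power K n *v z) < e"
    using matrix_power_K_uniformly_small[OF _ e(1)] by blast
  have in_T: "word_map c n x \<in> T" if "digits c" "x \<in> T" for c n x
    using that by (induction n arbitrary: x) (auto simp: digits_def piece_map_in_T)
  have "(\<lambda>x. x \<in> U) constant_on T"
  proof (rule constant_on_words_imp_constant[of _ N])
    fix c assume c: "digits c"
    have "(word_map c N x \<in> U) = (word_map c N y \<in> U)" if xy: "x \<in> T" "y \<in> T" for x y
    proof -
      have "dist (word_map c N x) (word_map c N y) < e"
        using N[of N "x - y"] xy by (auto simp: dist_norm word_map_eq matrix_vector_mult_diff_distrib)
      then show ?thesis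
        using e(2)[of "word_map c N x" "word_map c N y"] e(2)[of "word_map c N y" "word_map c N x"]
          UV(3) in_T[OF c] xy by (auto simp: dist_commute)
    qed
    then show "((\<lambda>x. x \<in> U) \<circ> word_map c N) constant_on T"
      using T_ne unfolding constant_on_def o_def by blast
  qed
  then obtain k where k: "\<And>x. x \<in> T \<Longrightarrow> (x \<in> U) = k" unfolding constant_on_def by blast
  obtain a b where "a \<in> U" "a \<in> T" "b \<in> V" "b \<in> T" using UV(5,6) by blast
  then show False using k[of a] k[of b] UV(4) by blast
qed

section \<open>Which subpieces meet\<close>

definition lattice_difference :: "int \<Rightarrow> int \<Rightarrow> bool" where
  "lattice_difference p q \<longleftrightarrow> (\<exists>x\<in>T. \<exists>y\<in>T. x - y = vector [of_int p, of_int q])"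

lemma lattice_difference_uminus: "lattice_difference p q \<Longrightarrow> lattice_difference (- p) (- q)"
proof -
  assume "lattice_difference p q"
  then obtain x y where xy: "x \<in> T" "y \<in> T" "x - y = vector [of_int p, of_int q]"
    by (auto simp: lattice_difference_def)
  have "y - x = - (x - y)" by simp
  also have "\<dots> = vector [of_int (- p), of_int (- q)]"
    unfolding xy(3) by (simp add: vec_eq_iff forall_2)
  finally show ?thesis using xy unfolding lattice_difference_def by blast
qed

lemma lattice_difference_step:
  assumes "lattice_difference p q"
  shows "\<exists>\<delta>. \<bar>\<delta>\<bar> \<le> B - 1 \<and> lattice_difference (- B * q - \<delta>) (p - A * q)"
proof -
  obtain x y where xy: "x \<in> T" "y \<in> T" "x - y = vector [of_int p, of_int q]"
    using assms by (auto simp: lattice_difference_def)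
  have child: "\<exists>d u. 0 \<le> d \<and> d < B \<and> u \<in> T \<and> M *v z = u + digit_vec d" if "z \<in> T" for z
  proof -
    have "M *v z \<in> (\<Union>d\<in>digit_set B. (\<lambda>x. x + d) ` T)" using that T_eq by blast
    then show ?thesis by (auto simp: digit_set_def)
  qed
  obtain d u e v where
    du: "0 \<le> d" "d < B" "u \<in> T" "M *v x = u + digit_vec d" and
    ev: "0 \<le> e" "e < B" "v \<in> T" "M *v y = v + digit_vec e"
    using child[OF xy(1)] child[OF xy(2)] by blast
  have "u - v = M *v (x - y) - (digit_vec d - digit_vec e)"
    using du ev by (simp add: matrix_vector_mult_diff_distrib)
  also have "\<dots> = vector [of_int (- B * q - (d - e)), of_int (p - A * q)]"
    unfolding xy(3) by (simp add: tile_matrix_mult_vec vec_eq_iff forall_2)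
  finally have "lattice_difference (- B * q - (d - e)) (p - A * q)"
    using du ev unfolding lattice_difference_def by blast
  then show ?thesis using du ev by (intro exI[of _ "d - e"]) auto
qed

lemma lattice_difference_walk:
  assumes "lattice_difference p q"
  obtains r where "bounded_walk A B r" "r 0 = q" "r 1 = A * q - p"
proof -
  define good where "good s \<longleftrightarrow> lattice_difference (fst s) (snd s)" for s
  \<comment> \<open>The first coordinate of the next vector is \<open>- B * snd s\<close> minus the digit difference, so this
    bounds the digit difference without naming it.\<close>
  define nxt where "nxt s s' \<longleftrightarrow> \<bar>B * snd s + fst s'\<bar> \<le> B - 1 \<and> snd s' = fst s - A * snd s"
    for s s' :: "int \<times> int"
  have "\<exists>f. \<forall>n. (good (f n) \<and> (n = 0 \<longrightarrow> f n = (p, q))) \<and> nxt (f n) (f (Suc n))"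
  proof (rule dependent_nat_choice)
    show "\<exists>s. good s \<and> (0 = 0 \<longrightarrow> s = (p, q))" using assms by (auto simp: good_def)
  next
    fix s and n :: nat assume "good s \<and> (n = 0 \<longrightarrow> s = (p, q))"
    then obtain \<delta> where "\<bar>\<delta>\<bar> \<le> B - 1" "good (- B * snd s - \<delta>, fst s - A * snd s)"
      using lattice_difference_step by (force simp: good_def)
    then show "\<exists>s'. (good s' \<and> (Suc n = 0 \<longrightarrow> s' = (p, q))) \<and> nxt s s'"
      by (intro exI[of _ "(- B * snd s - \<delta>, fst s - A * snd s)"]) (auto simp: nxt_def)
  qed
  then obtain f where f: "\<And>n. good (f n)" "f 0 = (p, q)" "\<And>n. nxt (f n) (f (Suc n))" by blast
  define r where "r n = (- 1) ^ n * snd (f n)" for n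
  have "\<bar>r (Suc (Suc n)) - A * r (Suc n) + B * r n\<bar> \<le> B - 1" for n
  proof -
    have "snd (f (Suc (Suc n))) + A * snd (f (Suc n)) = fst (f (Suc n))"
      using f(3)[of "Suc n"] by (simp add: nxt_def)
    then have "r (Suc (Suc n)) - A * r (Suc n) + B * r n
        = (- 1) ^ n * (B * snd (f n) + fst (f (Suc n)))"
      by (simp add: r_def algebra_simps flip: \<open>_ = fst (f (Suc n))\<close>)
    then show ?thesis using f(3)[of n] by (simp add: nxt_def abs_mult power_abs)
  qed
  moreover have "\<exists>C. \<forall>n. \<bar>r n\<bar> \<le> C"
  proof -
    obtain b where b: "\<And>x. x \<in> T \<Longrightarrow> norm x \<le> b"
      using compact_imp_bounded[OF compact_T] bounded_iff by metis
    have "\<bar>r n\<bar> \<le> \<lceil>2 * b\<rceil>" for n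
    proof -
      obtain x y where xy: "x \<in> T" "y \<in> T" "x - y = vector [of_int (fst (f n)), of_int (snd (f n))]"
        using f(1)[of n] by (auto simp: good_def lattice_difference_def)
      have "\<bar>real_of_int (snd (f n))\<bar> = \<bar>(x - y) $ 2\<bar>" unfolding xy(3) by simp
      also have "\<dots> \<le> norm (x - y)" by (rule component_le_norm_cart)
      also have "\<dots> \<le> 2 * b" using norm_triangle_ineq4[of x y] b[OF xy(1)] b[OF xy(2)] by linarith
      finally have "\<bar>snd (f n)\<bar> \<le> \<lceil>2 * b\<rceil>" by linarith
      then show ?thesis by (simp add: r_def abs_mult power_abs)
    qed
    then show ?thesis by blast
  qed
  ultimately have "bounded_walk A B r" by (simp add: bounded_walk_def)
  moreover have "r 0 = q" "r 1 = A * q - p"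
    using f(2) f(3)[of 0] by (auto simp: r_def nxt_def)
  ultimately show ?thesis using that by blast
qed

lemma lattice_difference_0: "lattice_difference k 0 \<Longrightarrow> \<bar>k\<bar> \<le> 1"
proof -
  have "- k \<le> 1" if k: "lattice_difference k 0" for k
  proof -
    obtain r where "bounded_walk A B r" "r 0 = 0" "r 1 = A * 0 - k"
      using lattice_difference_walk[OF k] .
    then show ?thesis using bounded_walk_from_0[of A B r] A_le_B gap by simp
  qed
  from this[of k] this[of "- k"] show "lattice_difference k 0 \<Longrightarrow> \<bar>k\<bar> \<le> 1"
    using lattice_difference_uminus[of k 0] by auto
qed

lemma lattice_difference_1: "lattice_difference p 1 \<Longrightarrow> p \<ge> A - 2"
proof -
  assume "lattice_difference p 1"
  then obtain r where "bounded_walk A B r" "r 0 = 1" "r 1 = A * 1 - p"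
    using lattice_difference_walk by blast
  then show ?thesis using bounded_walk_from_1[of A B r] A_le_B gap by simp
qed

lemma pieces_meet_imp_adjacent:
  assumes "piece_map d x = piece_map e y" "x \<in> T" "y \<in> T"
  shows "\<bar>d - e\<bar> \<le> 1"
proof -
  have "x - y = vector [of_int (e - d), of_int 0]"
    using assms(1) unfolding piece_map_eq_iff by (simp add: vec_eq_iff forall_2 algebra_simps)
  then have "lattice_difference (e - d) 0" using assms unfolding lattice_difference_def by blast
  then show ?thesis using lattice_difference_0 by fastforce
qed

text \<open>If the two points coincide, their preimages under the outer maps differ by \<open>digit_vec 1\<close>.
Applying \<open>M\<close> turns this into a vector with second coordinate \<open>1\<close>.\<close>

lemma subpieces_meet_imp:
  assumes "piece_map e (piece_map d x) = piece_map (e - 1) (piece_map d' y)" "x \<in> T" "y \<in> T"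
  shows "d' \<le> d - (A - 2)"
proof -
  define u v where "u = piece_map d x" and "v = piece_map d' y"
  have "v = u + digit_vec 1"
    using assms(1) unfolding piece_map_eq_iff u_def[symmetric] v_def[symmetric]
    by (simp add: vec_eq_iff forall_2 algebra_simps)
  then have "M *v v = M *v u + M *v digit_vec 1" by (simp add: matrix_vector_right_distrib)
  then have "y + digit_vec d' = x + digit_vec d + vector [0, 1]"
    unfolding u_def v_def M_piece_map by (simp add: tile_matrix_mult_vec)
  then have "y - x = vector [of_int (d - d'), of_int 1]"
    by (simp add: vec_eq_iff forall_2 algebra_simps)
  then have "lattice_difference (d - d') 1" using assms unfolding lattice_difference_def by blast
  then show ?thesis using lattice_difference_1 by fastforce
qed

section \<open>Cut points\<close>

definition lower :: "int \<Rightarrow> (real^2) set" where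
  "lower c = (\<Union>d\<in>{0..<c}. piece_map d ` T)"

definition upper :: "int \<Rightarrow> (real^2) set" where
  "upper c = (\<Union>d\<in>{c<..<B}. piece_map d ` T)"

lemma T_split:
  assumes "0 \<le> c" "c < B"
  shows "T = lower c \<union> piece_map c ` T \<union> upper c"
proof -
  have "{0..B - 1} = {0..<c} \<union> {c} \<union> {c<..<B}" using assms by auto
  then show ?thesis by (subst T_decomp) (simp only: lower_def upper_def UN_Un, simp)
qed

lemma lower_upper_disjoint: "lower c \<inter> upper c = {}"
  using pieces_meet_imp_adjacent by (fastforce simp: lower_def upper_def)

text \<open>A common point would lie in the piece with digit \<open>c - 1\<close>, in some subpiece of it with a digit
\<open>d'\<close> that satisfies \<open>d' \<le> d - (A - 2) < 0\<close>.\<close>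

lemma lower_avoids:
  assumes "c < B" "0 \<le> d" "d \<le> A - 3" "d < B" "x \<in> T"
  shows "piece_map c (piece_map d x) \<notin> lower c"
proof
  assume "piece_map c (piece_map d x) \<in> lower c"
  then obtain e y where e: "e < c" "y \<in> T" "piece_map c (piece_map d x) = piece_map e y"
    by (auto simp: lower_def)
  moreover have "piece_map d x \<in> T" using assms by (auto intro: piece_map_in_T)
  ultimately have e1: "e = c - 1" using pieces_meet_imp_adjacent[of c "piece_map d x" e y] by auto
  obtain d' z where d': "0 \<le> d'" "d' < B" "z \<in> T" "y = piece_map d' z"
    using ex_piece[OF e(2)] by blast
  then show False using subpieces_meet_imp[of c d x d' z] e e1 assms by auto
qed

text \<open>This is the mirror image: here the digit \<open>d'\<close> of the subpiece on the other side would be at least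
\<open>d + (A - 2) \<ge> B\<close>.\<close>

lemma upper_avoids:
  assumes "0 \<le> c" "0 \<le> d" "B - A + 2 \<le> d" "d < B" "x \<in> T"
  shows "piece_map c (piece_map d x) \<notin> upper c"
proof
  assume "piece_map c (piece_map d x) \<in> upper c"
  then obtain e y where e: "e > c" "y \<in> T" "piece_map c (piece_map d x) = piece_map e y"
    by (auto simp: upper_def)
  moreover have "piece_map d x \<in> T" using assms by (auto intro: piece_map_in_T)
  ultimately have e1: "c = e - 1" using pieces_meet_imp_adjacent[of c "piece_map d x" e y] by auto
  obtain d' z where d': "0 \<le> d'" "d' < B" "z \<in> T" "y = piece_map d' z"
    using ex_piece[OF e(2)] by blast
  then show False using subpieces_meet_imp[of e d' z d x] e e1 assms by auto
qed

lemma compact_piece: "compact (piece_map d ` T)"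
  using compact_word_map[OF compact_T, of "\<lambda>_. d" 1] by simp

text \<open>The two sides have to alternate: inside the piece with digit \<open>c n\<close>, the subpieces before
\<open>c (n + 1)\<close> cannot touch the pieces before \<open>c n\<close>, but may touch those after it, and
conversely. So pieces before and after change roles from one level to the next in the
families \<open>P\<close> and \<open>Q\<close>.\<close>

lemma cut_point_address:
  assumes c: "\<And>n. B - A + 2 \<le> c n" "\<And>n. c n \<le> A - 3"
  shows "cut_point T (address_point c)"
proof -
  have cB: "0 < c n" "c n < B - 1" for n using c[of n] A_le_B by linarith+
  then have c': "0 \<le> c n" "c n < B" for n by (smt (verit))+
  have dig: "digits c" using c' by (simp add: digits_def)
  define F where "F n = word_map c n ` T" for n
  define P where "P n = word_map c n ` (if even n then lower (c n) else upper (c n))" for n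
  define Q where "Q n = word_map c n ` (if even n then upper (c n) else lower (c n))" for n
  \<comment> \<open>Injectivity of the word maps reduces disjointness at all levels to these two facts about a
    piece and its subpieces.\<close>
  have low: "lower (c n) \<inter> piece_map (c n) ` (lower (c (Suc n)) \<union> piece_map (c (Suc n)) ` T) = {}" for n
    using lower_avoids c(2)[of "Suc n"] c'[of n] c'[of "Suc n"] by (force simp: lower_def[of "c (Suc n)"])
  have upp: "upper (c n) \<inter> piece_map (c n) ` (upper (c (Suc n)) \<union> piece_map (c (Suc n)) ` T) = {}" for n
    using upper_avoids c(1)[of "Suc n"] c'[of n] c'[of "Suc n"] by (force simp: upper_def[of "c (Suc n)"])
  have disj: "word_map c n ` X \<inter> word_map c n ` Y = {}" if "X \<inter> Y = {}" for n X Y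
    using that inj_word_map by (simp add: image_Int[symmetric])
  have "\<not> connected (F 0 - {address_point c})"
  proof (rule not_connected_by_nested_pieces[of F P Q])
    fix n
    have "compact (lower (c n))" "compact (upper (c n))"
      unfolding lower_def upper_def by (auto intro!: compact_UN compact_piece)
    then show "closed (F n)" "closed (P n)" "closed (Q n)"
      unfolding F_def P_def Q_def using compact_T
      by (auto intro!: compact_imp_closed compact_word_map)
    have "F n = word_map c n ` (lower (c n) \<union> piece_map (c n) ` T \<union> upper (c n))"
      unfolding F_def using T_split[OF c'] by simp
    then show "F n = P n \<union> F (Suc n) \<union> Q n"
      by (auto simp: F_def P_def Q_def image_Un image_comp)
    show "P n \<inter> Q n = {}"
      unfolding P_def Q_def using lower_upper_disjoint[of "c n"] by (intro disj) auto
    show "P n \<inter> Q (Suc n) = {}"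
      unfolding P_def Q_def word_map.simps image_comp[symmetric]
      using low[of n] upp[of n] by (intro disj) auto
    show "Q n \<inter> P (Suc n) = {}"
      unfolding P_def Q_def word_map.simps image_comp[symmetric]
      using low[of n] upp[of n] by (intro disj) auto
    show "P n \<inter> F (Suc (Suc n)) = {}"
      unfolding P_def F_def word_map.simps image_comp[symmetric]
      using low[of n] upp[of n] by (intro disj) auto
    show "Q n \<inter> F (Suc (Suc n)) = {}"
      unfolding Q_def F_def word_map.simps image_comp[symmetric]
      using low[of n] upp[of n] by (intro disj) auto
  next
    show "P 0 \<noteq> {}" using cB(1)[of 0] T_ne by (auto simp: P_def lower_def)
    have "B - 1 \<in> {c 0<..<B}" using cB(2)[of 0] by simp
    then show "Q 0 \<noteq> {}" using T_ne unfolding Q_def upper_def by auto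
    show "(\<Inter>n. F n) = {address_point c}" unfolding F_def by (rule address_point(1)[OF dig])
  qed
  then show ?thesis
    using connected_T address_point(3)[OF dig] by (simp add: cut_point_def F_def)
qed

end

theorem theorem3p2:
  fixes A B :: int and T :: "(real^2) set"
  assumes "0 < A" and "A \<le> B" and "B \<ge> 2"
    and "compact T" and "T \<noteq> {}"
    and "(\<lambda>x. tile_matrix A B *v x) ` T = (\<Union>d\<in>digit_set B. (\<lambda>x. x + d) ` T)"
    and "2 * A - B \<ge> 5"
  shows "cut_point T
    (\<Sum>j. matrix_power (matrix_inv (tile_matrix A B)) (Suc j) *v digit_vec (cut_digit A B (Suc j)))"
proof -
  interpret collinear_tile A B T using assms by unfold_locales auto
  have "cut_point T (address_point (\<lambda>j. cut_digit A B (Suc j)))"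
    using assms by (intro cut_point_address) (auto simp: cut_digit_def)
  then show ?thesis by (simp only: address_point_def)
qed

end
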